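(* Let $R$ be a finite chain ring of characteristic $p^c$ with $p$ prime and $c>1$, and let $k\ge 1$. Let $f=f_0+\sum_{i=1}^k f_i\beta_i\in R_k[x]$, where $f_0,\ldots,f_k\in R[x]$. Then the following statements are equivalent: (1) $f$ is a permutation polynomial on $R_k$; (2) $f_0$ is a permutation polynomial on $R_k$; (3) $f_0$ is a permutation polynomial on $R$.
   Context: Rings are associative with identity $1\ne 0$, not necessarily commutative. In a polynomial ring $A[x]$ the variable $x$ commutes with the coefficients. For $f=\sum_{i=0}^n a_ix^i\in A[x]$ and $b\in A$, put $f(b)=\sum_{i=0}^n a_ib^i$ (right substitution). $f\in A[x]$ is a permutation polynomial on $A$ if $b\mapsto f(b)$ is a bijection of $A$. A polynomial in $R[x]$ is also regarded as a polynomial in $R_k[x]$. $R_k=R[\beta_1,\ldots,\beta_k]$ (dual numbers in $k$ variables over $R$) is the quotient $R[x_1,\ldots,x_k]/T$, where $T$ is the ideal generated by all $x_ix_j$ ($1\le i,j\le k$) and $\beta_i=x_i+T$. It is the free $R$-algebra with basis $1,\beta_1,\ldots,\beta_k$, with $\beta_i$ central and $\beta_i\beta_j=0$ for all $1\le i,j\le k$. A finite ring is local if its zero-divisors form a two-sided ideal $M$ (then the unique maximal ideal); a finite chain ring is a finite local ring whose lattice of left ideals (equivalently, of right ideals) is a chain. The characteristic of a finite local ring is a power of a prime $p$. *)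

theory Defs
  imports
    "HOL-Computational_Algebra.Computational_Algebra"
    "HOL-Library.Poly_Mapping"
begin

section \<open>Finite local rings and finite chain rings\<close>

definition (in ring_1) left_ideal :: "'a set \<Rightarrow> bool" where
  "left_ideal I \<longleftrightarrow>
     0 \<in> I \<and> (\<forall>a\<in>I. \<forall>b\<in>I. a + b \<in> I) \<and> (\<forall>r. \<forall>a\<in>I. r * a \<in> I)"

definition (in ring_1) right_ideal :: "'a set \<Rightarrow> bool" where
  "right_ideal I \<longleftrightarrow>
     0 \<in> I \<and> (\<forall>a\<in>I. \<forall>b\<in>I. a + b \<in> I) \<and> (\<forall>r. \<forall>a\<in>I. a * r \<in> I)"

definition (in ring_1) two_sided_ideal :: "'a set \<Rightarrow> bool" where
  "two_sided_ideal I \<longleftrightarrow> left_ideal I \<and> right_ideal I"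

text \<open>Zero counts as a zero-divisor; the type class \<^class>\<open>ring_1\<close> contains the axiom \<open>0 \<noteq> 1\<close>.\<close>

definition (in ring_1) zero_divisor :: "'a \<Rightarrow> bool" where
  "zero_divisor a \<longleftrightarrow> (\<exists>b. b \<noteq> 0 \<and> (a * b = 0 \<or> b * a = 0))"

class finite_local_ring = ring_1 + finite +
  assumes zero_divisors_ideal: "two_sided_ideal {a. zero_divisor a}"

class finite_chain_ring = finite_local_ring +
  assumes left_ideals_chain: "left_ideal I \<Longrightarrow> left_ideal J \<Longrightarrow> I \<subseteq> J \<or> J \<subseteq> I"


section \<open>Polynomials over a noncommutative ring\<close>

text \<open>
  The library's \<^const>\<open>poly\<close> and its multiplication on \<open>'a poly\<close> require commutative
  coefficients, so evaluation and multiplication by a constant on the right are defined here.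
\<close>

definition right_subst :: "'a::ring_1 poly \<Rightarrow> 'a \<Rightarrow> 'a" where
  "right_subst f b = (\<Sum>i\<le>degree f. coeff f i * b ^ i)"

definition permutation_poly :: "'a::ring_1 poly \<Rightarrow> bool" where
  "permutation_poly f \<longleftrightarrow> bij (right_subst f)"

definition poly_mult_const :: "'a::ring_1 poly \<Rightarrow> 'a \<Rightarrow> 'a poly" where
  "poly_mult_const f c = map_poly (\<lambda>a. a * c) f"

lemma coeff_poly_mult_const: "coeff (poly_mult_const f c) i = coeff f i * c"
  by (simp add: poly_mult_const_def coeff_map_poly)


section \<open>Dual numbers in several variables\<close>

text \<open>
  The type \<open>('a, 'k) dual\<close> is the ring \<open>R[\<beta>\<^sub>1,\<dots>,\<beta>\<^sub>k]\<close> of dual numbers over \<open>R = 'a\<close>, with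
  the variables indexed by the finite (hence nonempty) type \<open>'k\<close>, \<open>k = CARD('k)\<close>.
  \<open>Dual a v\<close> stands for \<open>a + (\<Sum>i. v i * \<beta> i)\<close>.
\<close>

datatype ('a, 'k) dual = Dual (const_part: 'a) (dual_part: "'k \<Rightarrow> 'a")

instantiation dual :: (ring_1, type) ring_1
begin

definition "0 = Dual 0 (\<lambda>_. 0)"
definition "1 = Dual 1 (\<lambda>_. 0)"
definition "x + y = Dual (const_part x + const_part y) (\<lambda>i. dual_part x i + dual_part y i)"
definition "x - y = Dual (const_part x - const_part y) (\<lambda>i. dual_part x i - dual_part y i)"
definition "- x = Dual (- const_part x) (\<lambda>i. - dual_part x i)"
definition "x * y = Dual (const_part x * const_part y)
   (\<lambda>i. const_part x * dual_part y i + dual_part x i * const_part y)"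

instance
  by standard
    (auto simp: zero_dual_def one_dual_def plus_dual_def minus_dual_def uminus_dual_def
      times_dual_def algebra_simps)

end

lemmas dual_defs = zero_dual_def one_dual_def plus_dual_def minus_dual_def uminus_dual_def
  times_dual_def

instance dual :: (finite, finite) finite
proof
  have "(UNIV :: ('a, 'b) dual set) = (\<lambda>(a, v). Dual a v) ` UNIV"
    by (auto simp: image_iff) (metis dual.exhaust)
  then show "finite (UNIV :: ('a, 'b) dual set)"
    by (metis finite finite_imageI)
qed

definition dual_const :: "'a::ring_1 \<Rightarrow> ('a, 'k) dual" where
  "dual_const a = Dual a (\<lambda>_. 0)"

definition dual_var :: "'k \<Rightarrow> ('a::ring_1, 'k) dual" where
  "dual_var i = Dual 0 (\<lambda>j. if j = i then 1 else 0)"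

definition dual_poly :: "'a::ring_1 poly \<Rightarrow> ('a, 'k) dual poly" where
  "dual_poly f = map_poly dual_const f"


subsection \<open>The defining properties of the ring of dual numbers\<close>

lemma dual_const_hom:
  "dual_const 0 = 0" "dual_const 1 = 1"
  "dual_const (a + b) = dual_const a + dual_const b"
  "dual_const (a * b) = dual_const a * dual_const b"
  by (auto simp: dual_const_def dual_defs)

lemma dual_const_inj: "dual_const a = dual_const b \<longleftrightarrow> a = b"
  by (simp add: dual_const_def)

lemma dual_var_central: "dual_var i * x = x * dual_var i"
  by (auto simp: dual_var_def dual_defs)

lemma dual_var_mult_dual_var: "dual_var i * dual_var j = 0"
  by (auto simp: dual_var_def dual_defs)

lemma const_part_sum: "const_part (sum g A) = (\<Sum>i\<in>A. const_part (g i))"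
  by (induction A rule: infinite_finite_induct) (auto simp: dual_defs)

lemma dual_part_sum: "dual_part (sum g A) j = (\<Sum>i\<in>A. dual_part (g i) j)"
  by (induction A rule: infinite_finite_induct) (auto simp: dual_defs)

lemma dual_basis:
  fixes v :: "'k::finite \<Rightarrow> 'a::ring_1"
  shows "dual_const a + (\<Sum>i\<in>UNIV. dual_const (v i) * dual_var i) = Dual a v"
proof -
  have "dual_part (\<Sum>i\<in>UNIV. dual_const (v i) * dual_var i) j = v j" for j
    by (simp add: dual_part_sum)
      (simp add: dual_const_def dual_var_def times_dual_def if_distribR
        if_distrib[of "\<lambda>x. _ * x"] cong: if_cong)
  moreover have "const_part (\<Sum>i\<in>UNIV. dual_const (v i) * dual_var i) = 0"
    by (simp add: const_part_sum) (simp add: dual_const_def dual_var_def times_dual_def)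
  ultimately show ?thesis
    by (simp add: plus_dual_def) (simp add: dual_const_def)
qed


lemma coeff_dual_poly: "coeff (dual_poly f) i = dual_const (coeff f i)"
  by (simp add: dual_poly_def coeff_map_poly dual_const_hom)


subsection \<open>The ring of dual numbers as a quotient of a polynomial ring\<close>

text \<open>
  The type \<open>('k \<Rightarrow>\<^sub>0 nat) \<Rightarrow>\<^sub>0 'a\<close> is the polynomial ring over \<open>'a\<close> in central variables indexed
  by \<open>'k\<close>.  The map \<open>to_dual\<close> below is a surjective ring homomorphism onto the dual numbers which
  maps variables to variables and whose kernel is the ideal generated by all products of two variables.
\<close>

definition mvar :: "'k \<Rightarrow> (('k \<Rightarrow>\<^sub>0 nat) \<Rightarrow>\<^sub>0 'a::ring_1)" where
  "mvar i = Poly_Mapping.single (Poly_Mapping.single i 1) 1"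

definition ideal_gen :: "'a::ring_1 set \<Rightarrow> 'a set" where
  "ideal_gen S = \<Inter>{I. two_sided_ideal I \<and> S \<subseteq> I}"

definition to_dual :: "(('k \<Rightarrow>\<^sub>0 nat) \<Rightarrow>\<^sub>0 'a::ring_1) \<Rightarrow> ('a, 'k) dual" where
  "to_dual P = Dual (Poly_Mapping.lookup P 0)
     (\<lambda>i. Poly_Mapping.lookup P (Poly_Mapping.single i 1))"

lemma single_Suc_0_simps:
  "Poly_Mapping.single i (Suc 0) \<noteq> 0" "0 \<noteq> Poly_Mapping.single i (Suc 0)"
  "Poly_Mapping.single i (Suc 0) = Poly_Mapping.single j (Suc 0) \<longleftrightarrow> i = j"
proof -
  show "Poly_Mapping.single i (Suc 0) \<noteq> 0"
    by (metis lookup_single_eq lookup_zero nat.simps(3))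
  then show "0 \<noteq> Poly_Mapping.single i (Suc 0)" by metis
  show "Poly_Mapping.single i (Suc 0) = Poly_Mapping.single j (Suc 0) \<longleftrightarrow> i = j"
    by (metis lookup_single_eq lookup_single_not_eq nat.simps(3))
qed

lemma to_dual_0: "to_dual 0 = 0"
  by (simp add: to_dual_def zero_dual_def)

lemma to_dual_1: "to_dual 1 = 1"
  by (simp add: to_dual_def one_dual_def lookup_one when_def single_Suc_0_simps)

lemma to_dual_add: "to_dual (P + Q) = to_dual P + to_dual Q"
  by (simp add: to_dual_def plus_dual_def lookup_add)

lemma to_dual_const: "to_dual (Poly_Mapping.single 0 a) = dual_const a"
  by (simp add: to_dual_def dual_const_def lookup_single when_def single_Suc_0_simps)

lemma to_dual_single_var:
  "to_dual (Poly_Mapping.single (Poly_Mapping.single i 1) a) = dual_const a * dual_var i"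
  by (auto simp: to_dual_def dual_var_def dual_const_def times_dual_def lookup_single when_def
      single_Suc_0_simps)

lemma to_dual_mvar: "to_dual (mvar i) = dual_var i"
  by (simp add: mvar_def to_dual_single_var[simplified] dual_const_hom)

lemma monomial_add_eq_0: "m + n = 0 \<longleftrightarrow> m = 0 \<and> n = 0" for m n :: "'k \<Rightarrow>\<^sub>0 nat"
  by (auto simp: poly_mapping_eq_iff plus_poly_mapping.rep_eq fun_eq_iff)

lemma monomial_cases:
  fixes m :: "'k \<Rightarrow>\<^sub>0 nat"
  obtains "m = 0" | i where "m = Poly_Mapping.single i 1"
  | i j m' where "m = m' + Poly_Mapping.single i 1 + Poly_Mapping.single j 1"
proof -
  have split: "\<exists>i m'. m = m' + Poly_Mapping.single i 1" if nz: "m \<noteq> 0" for m :: "'k \<Rightarrow>\<^sub>0 nat"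
  proof -
    obtain i where i: "Poly_Mapping.lookup m i \<noteq> 0"
      using nz by (metis poly_mapping_eqI lookup_zero)
    have "m = (m - Poly_Mapping.single i 1) + Poly_Mapping.single i 1"
      using i by (intro poly_mapping_eqI) (auto simp: lookup_add lookup_minus lookup_single when_def)
    then show ?thesis by blast
  qed
  show thesis
  proof (cases "m = 0")
    case False
    then obtain i n where n: "m = n + Poly_Mapping.single i 1" using split by blast
    show thesis
    proof (cases "n = 0")
      case True
      then show thesis using n that(2) by simp
    next
      case False
      then obtain j n' where "n = n' + Poly_Mapping.single j 1" using split by blast
      then show thesis using n that(3) by blast
    qed
  qed (use that in blast)
qed

lemma single_ne_sum:
  "m + Poly_Mapping.single i 1 + Poly_Mapping.single j 1 \<noteq> (0 :: 'k \<Rightarrow>\<^sub>0 nat)"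
  "m + Poly_Mapping.single i 1 + Poly_Mapping.single j 1 \<noteq> Poly_Mapping.single l (1::nat)"
proof -
  let ?s = "m + Poly_Mapping.single i 1 + Poly_Mapping.single j 1"
  show "?s \<noteq> 0"
    by (simp add: monomial_add_eq_0 single_Suc_0_simps)
  show "?s \<noteq> Poly_Mapping.single l 1"
  proof
    assume eq: "?s = Poly_Mapping.single l 1"
    have at: "Poly_Mapping.lookup ?s x = Poly_Mapping.lookup (Poly_Mapping.single l (1::nat)) x" for x
      by (rule arg_cong[OF eq])
    show False
      using at[of i] at[of j] by (auto simp: lookup_add lookup_single when_def split: if_splits)
  qed
qed

lemma to_dual_single_high:
  "to_dual (Poly_Mapping.single (m + Poly_Mapping.single i 1 + Poly_Mapping.single j 1) a) = 0"
  using single_ne_sum[of m i j]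
  by (simp add: to_dual_def zero_dual_def lookup_single when_def fun_eq_iff)

lemma to_dual_mult_single:
  "to_dual (Poly_Mapping.single m a * Poly_Mapping.single n b) =
   to_dual (Poly_Mapping.single m a) * to_dual (Poly_Mapping.single n b)"
proof (cases m rule: monomial_cases)
  case 1
  note m = this
  show ?thesis
  proof (cases n rule: monomial_cases)
    case 1
    with m show ?thesis by (simp add: mult_single to_dual_const dual_const_hom)
  next
    case (2 j)
    with m show ?thesis
      by (simp add: mult_single to_dual_const to_dual_single_var[simplified] dual_const_hom mult.assoc)
  next
    case (3 j l n')
    with m show ?thesis by (simp add: mult_single to_dual_single_high[simplified])
  qed
next
  case (2 i)
  note m = this
  show ?thesis
  proof (cases n rule: monomial_cases)
    case 1
    with m show ?thesis
      by (simp add: mult_single to_dual_const to_dual_single_var[simplified])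
        (auto simp: dual_const_def dual_var_def times_dual_def)
  next
    case (2 j)
    have "to_dual (Poly_Mapping.single m a * Poly_Mapping.single n b) = 0"
      using to_dual_single_high[of 0 i j "a * b"] m 2 by (simp add: mult_single)
    moreover have "dual_const a * dual_var i * (dual_const b * dual_var j) = 0"
      by (simp add: dual_const_def dual_var_def times_dual_def zero_dual_def)
    ultimately show ?thesis using m 2 by (simp add: to_dual_single_var[simplified])
  next
    case (3 j l n')
    have "m + n = (m + n') + Poly_Mapping.single j 1 + Poly_Mapping.single l 1"
      using 3 by (simp add: add.assoc)
    then show ?thesis
      using 3 by (simp add: mult_single to_dual_single_high[simplified])
  qed
next
  case (3 i j m')
  have "m + n = (m' + n) + Poly_Mapping.single i 1 + Poly_Mapping.single j 1"
    using 3 by (simp add: ac_simps)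
  then show ?thesis
    using 3 by (simp add: mult_single to_dual_single_high[simplified])
qed

lemma poly_mapping_sum_single:
  "P = (\<Sum>m\<in>Poly_Mapping.keys P. Poly_Mapping.single m (Poly_Mapping.lookup P m))"
  by (rule poly_mapping_eqI)
    (simp add: lookup_sum lookup_single when_def in_keys_iff)

lemma to_dual_sum: "to_dual (sum g A) = (\<Sum>i\<in>A. to_dual (g i))"
  by (induction A rule: infinite_finite_induct) (auto simp: to_dual_0 to_dual_add)

lemma to_dual_mult: "to_dual (P * Q) = to_dual P * to_dual Q"
proof -
  define s where
    "s P = (\<Sum>m\<in>Poly_Mapping.keys P. Poly_Mapping.single m (Poly_Mapping.lookup P m))"
    for P :: "('b \<Rightarrow>\<^sub>0 nat) \<Rightarrow>\<^sub>0 'a"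
  have s: "s P = P" for P
    unfolding s_def by (rule poly_mapping_sum_single[symmetric])
  have "to_dual (s P * s Q) = to_dual (s P) * to_dual (s Q)"
    by (simp only: s_def sum_product to_dual_sum to_dual_mult_single)
  then show ?thesis by (simp only: s)
qed

lemma to_dual_surj: "surj (to_dual :: (('k::finite \<Rightarrow>\<^sub>0 nat) \<Rightarrow>\<^sub>0 'a::ring_1) \<Rightarrow> _)"
proof (rule surjI)
  fix x :: "('a, 'k) dual"
  show "to_dual (Poly_Mapping.single 0 (const_part x) +
      (\<Sum>i\<in>UNIV. Poly_Mapping.single (Poly_Mapping.single i 1) (dual_part x i))) = x"
    by (simp only: to_dual_add to_dual_sum to_dual_const to_dual_single_var dual_basis dual.collapse)
qed

lemma two_sided_ideal_kernel:
  "two_sided_ideal {P :: ('k \<Rightarrow>\<^sub>0 nat) \<Rightarrow>\<^sub>0 'a::ring_1. to_dual P = 0}"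
  by (simp add: two_sided_ideal_def left_ideal_def right_ideal_def to_dual_0 to_dual_add to_dual_mult)

lemma to_dual_kernel:
  "{P :: ('k \<Rightarrow>\<^sub>0 nat) \<Rightarrow>\<^sub>0 'a::ring_1. to_dual P = 0} = ideal_gen {mvar i * mvar j | i j. True}"
  (is "?K = ideal_gen ?S")
proof
  have "?S \<subseteq> ?K"
    by (auto simp: to_dual_mult to_dual_mvar dual_var_mult_dual_var)
  then show "ideal_gen ?S \<subseteq> ?K"
    using two_sided_ideal_kernel by (auto simp: ideal_gen_def)
  show "?K \<subseteq> ideal_gen ?S"
    unfolding ideal_gen_def
  proof (intro subsetI InterI, clarify)
    fix P :: "('k \<Rightarrow>\<^sub>0 nat) \<Rightarrow>\<^sub>0 'a" and I
    assume P: "to_dual P = 0" and I: "two_sided_ideal I" and S: "?S \<subseteq> I"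
    have zero: "0 \<in> I" and add: "\<And>a b. a \<in> I \<Longrightarrow> b \<in> I \<Longrightarrow> a + b \<in> I"
      and mult: "\<And>r a. a \<in> I \<Longrightarrow> r * a \<in> I"
      using I by (auto simp: two_sided_ideal_def left_ideal_def)
    have sum: "sum g A \<in> I" if "\<And>m. m \<in> A \<Longrightarrow> g m \<in> I" for g and A :: "('k \<Rightarrow>\<^sub>0 nat) set"
      using that by (induction A rule: infinite_finite_induct) (auto simp: zero add)
    have "Poly_Mapping.single m (Poly_Mapping.lookup P m) \<in> I" for m
    proof (cases m rule: monomial_cases)
      case 1
      then show ?thesis using P zero by (simp add: to_dual_def zero_dual_def)
    next
      case (2 i)
      then show ?thesis using P zero by (simp add: to_dual_def zero_dual_def fun_eq_iff)
    next
      case (3 i j m')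
      have "Poly_Mapping.single m (Poly_Mapping.lookup P m) =
          Poly_Mapping.single m' (Poly_Mapping.lookup P m) * (mvar i * mvar j)"
        using 3 by (simp add: mvar_def mult_single add.assoc)
      moreover have "mvar i * mvar j \<in> I" using S by blast
      ultimately show ?thesis using mult by metis
    qed
    then have "(\<Sum>m\<in>Poly_Mapping.keys P. Poly_Mapping.single m (Poly_Mapping.lookup P m)) \<in> I"
      by (intro sum)
    then show "P \<in> I" by (simp only: poly_mapping_sum_single[symmetric])
  qed
qed

end

theory Submission
  imports Defs
begin

text \<open>
  On \<open>R\<^sub>k\<close> one has \<open>f (a + \<Sum>i. v\<^sub>i \<beta>\<^sub>i) = f\<^sub>0 a + \<Sum>i. (D\<^sub>a v\<^sub>i + f\<^sub>i a) \<beta>\<^sub>i\<close>, where \<open>D\<^sub>a\<close> is the additive map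
  \<open>b \<mapsto> \<Sum>n. c\<^sub>n (\<Sum>j<n. a\<^sup>j b a\<^sup>n\<^sup>-\<^sup>1\<^sup>-\<^sup>j)\<close> attached to \<open>f\<^sub>0 = \<Sum>n. c\<^sub>n x\<^sup>n\<close>.  Hence \<open>f\<close> is a permutation
  polynomial iff \<open>f\<^sub>0\<close> is one on \<open>R\<close> and every \<open>D\<^sub>a\<close> is injective, and it remains to derive the
  injectivity from the former.

  Left ideals of a finite chain ring are two-sided, so for every \<open>b\<close> there is an \<open>a'\<close> with \<open>b a = a' b\<close>, and
  then \<open>D\<^sub>a b = E b\<close>, where \<open>E\<close> is the difference quotient of \<open>f\<^sub>0\<close> at \<open>a, a'\<close>.  The residue ring is a
  finite division ring, hence commutative by Wedderburn's little theorem.  If \<open>a\<close> and \<open>a'\<close> have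
  distinct residues, then \<open>E\<close> is a unit because \<open>f\<^sub>0\<close> permutes the residue field.  If the residues
  agree, then \<open>E\<close> is the derivative of \<open>f\<^sub>0\<close> at \<open>a\<close> modulo the maximal ideal; it is a unit because
  \<open>f\<^sub>0\<close> is injective on the coset \<open>a + q R\<close>, where \<open>q = p\<^sup>c\<^sup>-\<^sup>1\<close> is central, nonzero and of square
  zero (this uses \<open>c > 1\<close>).

  Wedderburn's theorem is proved as follows.  Let \<open>K\<close> be a maximal subfield of a noncommutative
  finite division ring.  Averaging over the conjugation action of the group of units of \<open>K\<close> yields
  an element \<open>y \<notin> K\<close> and an exponent \<open>j\<close> with \<open>y h = h\<^sup>j y\<close> for all \<open>h \<noteq> 0\<close> in \<open>K\<close>; let \<open>n\<close> be the
  order of \<open>h \<mapsto> h\<^sup>j\<close>.  Two elements \<open>w\<close> of \<open>K y - {0}\<close> with the same \<open>w\<^sup>n\<close> are conjugate under \<open>K\<close>,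
  so by counting some \<open>w\<close> satisfies \<open>w\<^sup>n = 1\<close>, hence \<open>1 + w + \<dots> + w\<^sup>n\<^sup>-\<^sup>1 = 0\<close>, against the
  independence of the powers of \<open>w\<close> over \<open>K\<close>.
\<close>


section \<open>Wedderburn's little theorem\<close>

lemma card_eq_card_image_times_fibre:
  assumes "finite S" and "\<And>y. y \<in> g ` S \<Longrightarrow> card {x \<in> S. g x = y} = m"
  shows "card S = card (g ` S) * m"
proof -
  have "card S = (\<Sum>x\<in>S. 1)" by simp
  also have "\<dots> = (\<Sum>y\<in>g ` S. \<Sum>x\<in>{x \<in> S. g x = y}. 1)"
    using sum.image_gen[OF assms(1)] by blast
  also have "\<dots> = (\<Sum>y\<in>g ` S. m)" using assms(2) by (intro sum.cong) auto
  finally show ?thesis by simp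
qed

lemma geometric_sum_ring_1: "(x - 1) * (\<Sum>i<n. x ^ i) = x ^ n - (1 :: 'a::ring_1)"
  by (induction n) (simp_all add: algebra_simps)

text \<open>Translation by 1 permutes the ring, so the sum of all elements is unchanged when 1 is
  added to each of them.\<close>

lemma of_nat_card_UNIV_eq_0: "(of_nat (card (UNIV :: 'a set)) :: 'a::{ring_1,finite}) = 0"
proof -
  have "(\<Sum>x\<in>UNIV. x + 1) = (\<Sum>x\<in>UNIV. x :: 'a)"
    by (rule sum.reindex_bij_witness[of _ "\<lambda>x. x - 1" "\<lambda>x. x + 1"]) auto
  then show ?thesis by (simp add: sum.distrib)
qed

lemma power_diff_eq_1:
  fixes x :: "'a::division_ring"
  assumes "x \<noteq> 0" "i < j" "x ^ i = x ^ j"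
  shows "x ^ (j - i) = 1"
proof -
  have "x ^ i * x ^ (j - i) = x ^ j" unfolding power_add[symmetric] using assms(2) by simp
  then have "x ^ i * x ^ (j - i) = x ^ i * 1" using assms(3) by simp
  then show ?thesis
    using mult_left_cancel[OF power_not_zero[OF assms(1)]] by blast
qed

lemma ex_power_eq_1_finite:
  fixes x :: "'a::{division_ring,finite}"
  assumes "x \<noteq> 0"
  shows "\<exists>d>0. x ^ d = 1"
proof -
  have "\<not> inj (\<lambda>i::nat. x ^ i)"
    using finite_imageD[of "\<lambda>i::nat. x ^ i" UNIV] by auto
  then obtain i j where "i < j" "x ^ i = x ^ j"
    unfolding inj_def by (metis linorder_neqE_nat)
  then show ?thesis using power_diff_eq_1[OF assms] by (intro exI[of _ "j - i"]) simp
qed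

text \<open>Lagrange's theorem for the group of powers of \<open>x\<close>: for nonzero
  \<open>z\<close> the sets \<open>C z\<close> are its cosets, of size the order \<open>d\<close> of
  \<open>x\<close>, and they partition the nonzero elements.\<close>

lemma power_card_minus_1_eq_1:
  fixes x :: "'a::{division_ring,finite}"
  assumes x: "x \<noteq> 0"
  shows "x ^ (card (UNIV :: 'a set) - 1) = 1"
proof -
  define d where "d = (LEAST d. 0 < d \<and> x ^ d = 1)"
  have d: "0 < d" "x ^ d = 1"
    using LeastI_ex[of "\<lambda>d. 0 < d \<and> x ^ d = 1"] ex_power_eq_1_finite[OF x] by (auto simp: d_def)
  have minimal: "x ^ e \<noteq> 1" if "0 < e" "e < d" for e
    using not_less_Least[of e "\<lambda>d. 0 < d \<and> x ^ d = 1"] that by (auto simp: d_def)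
  define C where "C z = range (\<lambda>i::nat. z * x ^ i)" for z
  have xmod: "x ^ i = x ^ (i mod d)" for i
  proof -
    have "x ^ i = x ^ (d * (i div d) + i mod d)" by simp
    also have "\<dots> = x ^ (i mod d)" by (simp only: power_add power_mult d power_one mult_1_left)
    finally show ?thesis .
  qed
  have card_C: "card (C z) = d" if "z \<noteq> 0" for z
  proof -
    have less: False if "i < j" "j < d" "z * x ^ i = z * x ^ j" for i j
      using power_diff_eq_1[OF x that(1)] minimal[of "j - i"] that \<open>z \<noteq> 0\<close> by simp
    have "inj_on (\<lambda>i. z * x ^ i) {..<d}"
      by (rule inj_onI) (metis less lessThan_iff linorder_neqE_nat)
    moreover have "C z = (\<lambda>i. z * x ^ i) ` {..<d}"
      unfolding C_def using xmod d(1) by (auto simp: image_iff) (metis lessThan_iff mod_less_divisor)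
    ultimately show ?thesis by (simp add: card_image)
  qed
  have eq_iff: "C w = C z \<longleftrightarrow> w \<in> C z" for w z
  proof
    assume "C w = C z"
    moreover have "w \<in> C w" unfolding C_def by (rule range_eqI[of _ _ 0]) simp
    ultimately show "w \<in> C z" by simp
  next
    assume "w \<in> C z"
    then obtain i where w: "w = z * x ^ i" by (auto simp: C_def)
    \<comment> \<open>Completes \<open>i mod d\<close> to a full period, so \<open>x ^ i'\<close>
      inverts \<open>x ^ i\<close> and \<open>z\<close> is recovered from \<open>w\<close>.\<close>
    define i' where "i' = d - i mod d"
    have "x ^ (i + i') = x ^ (i mod d + i')" by (simp only: power_add xmod[of i])
    also have "\<dots> = 1" using d by (simp add: i'_def)
    finally have z: "z = w * x ^ i'" by (simp add: w mult.assoc flip: power_add)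
    have "w * x ^ e = z * x ^ (i + e)" for e by (simp only: w mult.assoc power_add)
    moreover have "z * x ^ e = w * x ^ (i' + e)" for e
      by (subst z) (simp only: mult.assoc power_add)
    ultimately show "C w = C z" unfolding C_def by blast
  qed
  have "card (UNIV - {0 :: 'a}) = card (C ` (UNIV - {0})) * d"
  proof (rule card_eq_card_image_times_fibre)
    fix y assume "y \<in> C ` (UNIV - {0})"
    then obtain z where z: "z \<noteq> 0" "y = C z" by auto
    have "w \<noteq> 0" if "w \<in> C z" for w using that z(1) x by (auto simp: C_def)
    then have "{w \<in> UNIV - {0}. C w = y} = C z" using eq_iff z(2) by auto
    then show "card {w \<in> UNIV - {0}. C w = y} = d" using card_C z by simp
  qed simp
  then have "card (UNIV :: 'a set) - 1 = d * card (C ` (UNIV - {0 :: 'a}))"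
    by (simp add: card_Diff_singleton)
  then show ?thesis by (simp add: power_mult d(2))
qed

lemma power_mult_distrib_commuting:
  fixes x y :: "'a::monoid_mult"
  assumes "x * y = y * x"
  shows "(x * y) ^ n = x ^ n * y ^ n"
proof (induction n)
  case (Suc n)
  have "(x * y) ^ Suc n = x * (y * x ^ n) * y ^ n"
    using Suc by (simp add: mult.assoc)
  also have "y * x ^ n = x ^ n * y"
    using power_commuting_commutes[OF assms] by simp
  finally show ?case by (simp add: mult.assoc)
qed simp

lemma conjugate_eq_iff:
  fixes c :: "'a::division_ring"
  assumes "c \<noteq> 0"
  shows "c * w * inverse c = z \<longleftrightarrow> c * w = z * c"
proof
  assume "c * w = z * c"
  then show "c * w * inverse c = z" using assms by (simp add: mult.assoc)
qed (use assms in \<open>auto simp: mult.assoc\<close>)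

section \<open>Maximal subfields and the conjugation action of their units\<close>

locale maximal_commuting_set =
  fixes K :: "'a::{division_ring,finite} set"
  assumes commute: "x \<in> K \<Longrightarrow> y \<in> K \<Longrightarrow> x * y = y * x"
    and maximal: "(\<And>y. y \<in> K \<Longrightarrow> x * y = y * x) \<Longrightarrow> x \<in> K"
begin

text \<open>\<open>K\<close> is its own centralizer, so closure under each field operation reduces
  to a commutation check.\<close>

lemma zero_mem: "0 \<in> K" and one_mem: "1 \<in> K"
  by (auto intro: maximal)

lemma add_mem: "x \<in> K \<Longrightarrow> y \<in> K \<Longrightarrow> x + y \<in> K"
  by (rule maximal) (simp add: algebra_simps commute)

lemma uminus_mem: "x \<in> K \<Longrightarrow> - x \<in> K"
  by (rule maximal) (simp add: commute)

lemma diff_mem: "x \<in> K \<Longrightarrow> y \<in> K \<Longrightarrow> x - y \<in> K"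
  using add_mem[of x "- y"] uminus_mem[of y] by simp

lemma sum_mem: "(\<And>i. i \<in> I \<Longrightarrow> g i \<in> K) \<Longrightarrow> sum g I \<in> K"
  by (induction I rule: infinite_finite_induct) (auto simp: zero_mem add_mem)

lemma mult_mem: "x \<in> K \<Longrightarrow> y \<in> K \<Longrightarrow> x * y \<in> K"
  by (rule maximal) (metis commute mult.assoc)

lemma power_mem: "x \<in> K \<Longrightarrow> x ^ n \<in> K"
  by (induction n) (auto simp: one_mem mult_mem)

lemma inverse_mem: "x \<in> K \<Longrightarrow> inverse x \<in> K"
  by (rule maximal) (metis commute mult_commute_imp_mult_inverse_commute)

abbreviation Kx :: "'a set" where "Kx \<equiv> K - {0}"

text \<open>For nonzero \<open>u\<close>, conjugation by \<open>u\<close> is the power map with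
  exponent \<open>e\<close>. Allowing \<open>h = 0\<close> would force \<open>u = 0\<close> when
  \<open>e = 0\<close>, because \<open>0 ^ 0 = 1\<close>.\<close>

definition twist :: "nat \<Rightarrow> 'a \<Rightarrow> bool" where
  "twist e u \<longleftrightarrow> (\<forall>h\<in>Kx. u * h = h ^ e * u)"

lemma twistD: "twist e u \<Longrightarrow> h \<in> Kx \<Longrightarrow> u * h = h ^ e * u"
  by (auto simp: twist_def)

lemma twist_power: "twist j w \<Longrightarrow> twist (j ^ i) (w ^ i)"
proof (induction i)
  case (Suc i)
  show ?case unfolding twist_def
  proof
    fix h assume h: "h \<in> Kx"
    have "w ^ Suc i * h = w * (h ^ (j ^ i) * w ^ i)"
      using twistD[OF Suc.IH h] Suc.prems by (simp add: mult.assoc)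
    also have "\<dots> = (h ^ (j ^ i)) ^ j * w * w ^ i"
      using twistD[OF Suc.prems, of "h ^ (j ^ i)"] h by (simp add: power_mem mult.assoc[symmetric])
    finally show "w ^ Suc i * h = h ^ (j ^ Suc i) * w ^ Suc i"
      by (simp add: power_mult[symmetric] mult.assoc mult.commute[of j])
  qed
qed (simp add: twist_def)

lemma mult_twist: "twist e u \<Longrightarrow> k \<in> K \<Longrightarrow> twist e (k * u)"
  unfolding twist_def by (metis DiffD1 commute mult.assoc power_mem)

text \<open>The isotypic components of the conjugation action are at most one-dimensional over \<open>K\<close>.\<close>

lemma twist_quotient_mem:
  assumes u: "twist e u" and v: "twist e v" "v \<noteq> 0"
  shows "u * inverse v \<in> K"
proof (rule maximal)
  have e: "h ^ e = v * h * inverse v" if "h \<in> Kx" for h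
    using twistD[OF v(1) that] v(2) by (simp add: mult.assoc)
  \<comment> \<open>The power map is conjugation by \<open>v\<close>, hence injective and by
    finiteness a permutation of \<open>Kx\<close>; every nonzero \<open>g\<close> is thus some
    \<open>h ^ e\<close>, for which both twist relations are available.\<close>
  have inj: "inj_on (\<lambda>h. h ^ e) Kx"
    by (rule inj_onI) (use e v(2) in auto)
  have "(\<lambda>h. h ^ e) ` Kx \<subseteq> Kx" by (auto simp: power_mem)
  then have surj: "(\<lambda>h. h ^ e) ` Kx = Kx"
    using inj by (intro endo_inj_surj) auto
  fix g assume g: "g \<in> K"
  show "u * inverse v * g = g * (u * inverse v)"
  proof (cases "g = 0")
    case False
    then obtain h where h: "h \<in> Kx" "g = h ^ e" using surj g by (metis DiffI imageE singletonD)
    have "u * inverse v * g = u * h * inverse v"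
      using e[OF h(1)] h(2) v(2) by (simp add: mult.assoc[symmetric])
        (simp add: mult.assoc)
    also have "\<dots> = g * (u * inverse v)"
      using twistD[OF u h(1)] h(2) by (simp add: mult.assoc)
    finally show ?thesis .
  qed simp
qed

text \<open>Orthogonality of characters: substituting \<open>h * k\<close> for \<open>k\<close>
  multiplies the sum by \<open>h ^ e * inverse h\<close>, which is not 1.\<close>

lemma sum_character_eq_0:
  assumes "h \<in> Kx" "h ^ e \<noteq> h"
  shows "(\<Sum>k\<in>Kx. k ^ e * inverse k) = 0"
proof -
  let ?T = "\<Sum>k\<in>Kx. k ^ e * inverse k"
  have "?T = (\<Sum>k\<in>Kx. (h * k) ^ e * inverse (h * k))"
    by (rule sum.reindex_bij_witness[of _ "\<lambda>k. h * k" "\<lambda>k. inverse h * k"])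
      (use assms in \<open>auto simp: mult_mem inverse_mem mult.assoc[symmetric]\<close>)
  also have "\<dots> = (\<Sum>k\<in>Kx. h ^ e * inverse h * (k ^ e * inverse k))"
  proof (rule sum.cong)
    fix k assume k: "k \<in> Kx"
    have "(h * k) ^ e = h ^ e * k ^ e"
      using k assms by (intro power_mult_distrib_commuting commute) auto
    moreover have "inverse (h * k) = inverse h * inverse k"
      using k assms by (metis DiffD1 DiffD2 commute nonzero_inverse_mult_distrib singletonI)
    moreover have "k ^ e * inverse h = inverse h * k ^ e"
      using k assms by (intro commute) (auto simp: power_mem inverse_mem)
    ultimately show "(h * k) ^ e * inverse (h * k) = h ^ e * inverse h * (k ^ e * inverse k)"
      by (simp add: mult.assoc) (simp add: mult.assoc[symmetric])
  qed simp
  also have "\<dots> = h ^ e * inverse h * ?T" by (simp add: sum_distrib_left)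
  finally have "(h ^ e * inverse h - 1) * ?T = 0" by (simp add: algebra_simps)
  moreover have "h ^ e * inverse h \<noteq> 1"
    using assms by (metis inverse_inverse_eq inverse_unique)
  ultimately show ?thesis by simp
qed

text \<open>Translation by 1 permutes \<open>K\<close>, so \<open>card K\<close> vanishes in the
  ring. The order of \<open>Kx\<close> is therefore invertible, and averaging over \<open>Kx\<close>
  only costs a sign.\<close>

lemma of_nat_card_Kx: "(of_nat (card Kx) :: 'a) = - 1"
proof -
  have "(\<Sum>x\<in>K. x + 1) = (\<Sum>x\<in>K. x)"
    by (rule sum.reindex_bij_witness[of _ "\<lambda>x. x - 1" "\<lambda>x. x + 1"])
      (simp_all add: add_mem diff_mem one_mem)
  then have "(of_nat (card K) :: 'a) = 0" by (simp add: sum.distrib)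
  moreover have "card K = Suc (card Kx)"
    using card.remove[OF _ zero_mem] by simp
  ultimately show ?thesis by (simp add: eq_neg_iff_add_eq_0 add.commute)
qed

lemma sum_conjugates_twist:
  assumes "twist e u"
  shows "(\<Sum>k\<in>Kx. k * u * inverse k) = (\<Sum>k\<in>Kx. k ^ e * inverse k) * u"
proof -
  have "(\<Sum>k\<in>Kx. k * u * inverse k) = (\<Sum>k\<in>Kx. inverse k * u * k)"
    by (rule sum.reindex_bij_witness[of _ inverse inverse]) (auto simp: inverse_mem)
  also have "\<dots> = (\<Sum>k\<in>Kx. k ^ e * inverse k * u)"
  proof (rule sum.cong)
    fix k assume k: "k \<in> Kx"
    have "inverse k * k ^ e = k ^ e * inverse k"
      using k by (intro commute) (auto simp: power_mem inverse_mem)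
    then show "inverse k * u * k = k ^ e * inverse k * u"
      using twistD[OF assms k] by (simp add: mult.assoc) (simp add: mult.assoc[symmetric])
  qed simp
  finally show ?thesis by (simp add: sum_distrib_right)
qed

text \<open>Substituting \<open>h * k\<close> for \<open>k\<close> lets
  \<open>inverse (h * k) * h\<close> collapse to \<open>inverse k\<close> and releases the factor
  \<open>h ^ e\<close>.\<close>

lemma twist_sum:
  "twist e (\<Sum>k\<in>Kx. k ^ e * x * inverse k)"
  unfolding twist_def
proof
  fix h assume h: "h \<in> Kx"
  have "(\<Sum>k\<in>Kx. k ^ e * x * inverse k) * h = (\<Sum>k\<in>Kx. k ^ e * x * inverse k * h)"
    by (simp add: sum_distrib_right)
  also have "\<dots> = (\<Sum>k\<in>Kx. (h * k) ^ e * x * inverse (h * k) * h)"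
    by (rule sum.reindex_bij_witness[of _ "\<lambda>k. h * k" "\<lambda>k. inverse h * k"])
      (use h in \<open>auto simp: mult_mem inverse_mem mult.assoc[symmetric]\<close>)
  also have "\<dots> = (\<Sum>k\<in>Kx. h ^ e * (k ^ e * x * inverse k))"
  proof (rule sum.cong)
    fix k assume k: "k \<in> Kx"
    have "(h * k) ^ e = h ^ e * k ^ e"
      using k h by (intro power_mult_distrib_commuting commute) auto
    moreover have "inverse (h * k) * h = inverse k"
      using k h by (simp add: nonzero_inverse_mult_distrib mult.assoc)
    ultimately show "(h * k) ^ e * x * inverse (h * k) * h = h ^ e * (k ^ e * x * inverse k)"
      by (simp add: mult.assoc)
  qed simp
  finally show "(\<Sum>k\<in>Kx. k ^ e * x * inverse k) * h = h ^ e * (\<Sum>k\<in>Kx. k ^ e * x * inverse k)"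
    by (simp add: sum_distrib_left)
qed

text \<open>Averaging over the characters \<open>k \<mapsto> k ^ e\<close> decomposes every element into isotypic components.\<close>

lemma sum_twist_components:
  "(\<Sum>e<card (UNIV :: 'a set) - 1. \<Sum>k\<in>Kx. k ^ e * x * inverse k) = - x"
proof -
  let ?N = "card (UNIV :: 'a set) - 1"
  \<comment> \<open>A geometric sum with \<open>k ^ ?N = 1\<close>: only \<open>k = 1\<close>
    survives, with value \<open>?N\<close>, which is \<open>- 1\<close> in the ring.\<close>
  have geom: "(\<Sum>e<?N. k ^ e) = (if k = 1 then - 1 else 0)" if "k \<in> Kx" for k
  proof (cases "k = 1")
    case True
    have "card (UNIV :: 'a set) = Suc ?N"
      using finite_UNIV_card_ge_0[where 'a='a] by simp
    then have "(1 + of_nat ?N :: 'a) = 0"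
      using of_nat_card_UNIV_eq_0[where 'a='a] by (metis of_nat_Suc)
    then show ?thesis using True by (simp add: eq_neg_iff_add_eq_0 add.commute)
  next
    case False
    have "(k - 1) * (\<Sum>e<?N. k ^ e) = 0"
      using geometric_sum_ring_1[of k ?N] power_card_minus_1_eq_1[of k] that by simp
    then show ?thesis using False by simp
  qed
  have "(\<Sum>e<?N. \<Sum>k\<in>Kx. k ^ e * x * inverse k) = (\<Sum>k\<in>Kx. \<Sum>e<?N. k ^ e * x * inverse k)"
    by (rule sum.swap)
  also have "\<dots> = (\<Sum>k\<in>Kx. (\<Sum>e<?N. k ^ e) * x * inverse k)"
    by (simp add: sum_distrib_right)
  also have "\<dots> = (\<Sum>k\<in>Kx. if k = 1 then - x else 0)"
    using geom by (intro sum.cong) auto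
  also have "\<dots> = - x" using one_mem by simp
  finally show ?thesis .
qed

lemma ex_twist_not_mem:
  assumes "x \<notin> K"
  obtains e y where "twist e y" "y \<notin> K"
proof -
  have "\<exists>e. (\<Sum>k\<in>Kx. k ^ e * x * inverse k) \<notin> K"
  proof (rule ccontr)
    assume "\<nexists>e. (\<Sum>k\<in>Kx. k ^ e * x * inverse k) \<notin> K"
    then have "(\<Sum>e<card (UNIV :: 'a set) - 1. \<Sum>k\<in>Kx. k ^ e * x * inverse k) \<in> K"
      by (intro sum_mem[where g = "\<lambda>e. \<Sum>k\<in>Kx. k ^ e * x * inverse k"]) blast
    then have "- x \<in> K" by (simp only: sum_twist_components)
    then show False using uminus_mem[of "- x"] assms by simp
  qed
  then show ?thesis using that twist_sum by blast
qed

end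

section \<open>The cyclic field extension given by conjugation with \<open>y\<close>\<close>

locale cyclic_twist = maximal_commuting_set K for K :: "'a::{division_ring,finite} set" +
  fixes y :: 'a and j n :: nat
  assumes twist_y: "twist j y" and y_nz: "y \<noteq> 0" and n_pos: "n > 0"
    and period: "h \<in> Kx \<Longrightarrow> h ^ (j ^ n) = h"
    and n_minimal: "0 < i \<Longrightarrow> i < n \<Longrightarrow> \<exists>h\<in>Kx. h ^ (j ^ i) \<noteq> h"
begin

text \<open>By \<open>n_minimal\<close>, orthogonality applies to every iterate of the power map
  with \<open>0 < i < n\<close>.\<close>

lemma sum_character:
  assumes "i < n"
  shows "(\<Sum>k\<in>Kx. k ^ (j ^ i) * inverse k) = (if i = 0 then - 1 else 0)"
proof (cases "i = 0")
  case True
  then have "(\<Sum>k\<in>Kx. k ^ (j ^ i) * inverse k) = of_nat (card Kx)" by simp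
  then show ?thesis unfolding of_nat_card_Kx using True by simp
next
  case False
  then obtain h where "h \<in> Kx" "h ^ (j ^ i) \<noteq> h" using n_minimal[of i] assms by blast
  then have "(\<Sum>k\<in>Kx. k ^ (j ^ i) * inverse k) = 0" by (rule sum_character_eq_0)
  then show ?thesis using False by simp
qed

text \<open>Summing all conjugates under \<open>Kx\<close> kills the components with
  \<open>0 < i < n\<close> and negates \<open>u 0\<close>. This supplies the independence of the
  powers of an element of \<open>X\<close>.\<close>

lemma twist_sum_eq_0:
  assumes "\<And>i. i < n \<Longrightarrow> twist (j ^ i) (u i)" and "(\<Sum>i<n. u i) = 0"
  shows "u 0 = 0"
proof -
  have "0 = (\<Sum>k\<in>Kx. k * (\<Sum>i<n. u i) * inverse k)" using assms(2) by simp
  also have "\<dots> = (\<Sum>k\<in>Kx. \<Sum>i<n. k * u i * inverse k)"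
    by (simp add: sum_distrib_left sum_distrib_right)
  also have "\<dots> = (\<Sum>i<n. \<Sum>k\<in>Kx. k * u i * inverse k)" by (rule sum.swap)
  also have "\<dots> = (\<Sum>i<n. if i = 0 then - u i else 0)"
  proof (rule sum.cong)
    fix i assume "i \<in> {..<n}"
    then have i: "i < n" by simp
    show "(\<Sum>k\<in>Kx. k * u i * inverse k) = (if i = 0 then - u i else 0)"
      unfolding sum_conjugates_twist[OF assms(1)[OF i]] sum_character[OF i] by simp
  qed simp
  also have "\<dots> = (if 0 \<in> {..<n} then - u 0 else 0)" by (rule sum.delta) simp
  also have "\<dots> = - u 0" using n_pos by simp
  finally show ?thesis by simp
qed

definition X :: "'a set" where "X = (\<lambda>k. k * y) ` Kx"
text \<open>The unit group of the fixed field of the automorphism of \<open>K\<close> induced by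
  \<open>y\<close>.\<close>

definition Fx :: "'a set" where "Fx = {c \<in> Kx. c ^ j = c}"

lemma twist_X: "w \<in> X \<Longrightarrow> twist j w" and X_nz: "w \<in> X \<Longrightarrow> w \<noteq> 0"
  using y_nz by (auto simp: X_def intro: mult_twist twist_y)

lemma card_X: "card X = card Kx"
  unfolding X_def using y_nz by (intro card_image inj_onI) auto

lemma Fx_commute:
  assumes "w \<in> X" "c \<in> Kx"
  shows "c \<in> Fx \<longleftrightarrow> w * c = c * w"
proof -
  have "w * c = c * w \<longleftrightarrow> c ^ j = c"
    unfolding twistD[OF twist_X[OF assms(1)] assms(2)] using X_nz[OF assms(1)] by simp
  then show ?thesis using assms(2) by (simp add: Fx_def)
qed

text \<open>By \<open>period\<close>, \<open>w ^ n\<close> centralizes \<open>K\<close> and so lies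
  in it; as it commutes with \<open>w\<close>, it is also fixed.\<close>

lemma power_n_mem: assumes "w \<in> X" shows "w ^ n \<in> Fx"
proof -
  have "w ^ n \<in> K"
  proof (rule maximal)
    fix h assume h: "h \<in> K"
    show "w ^ n * h = h * w ^ n"
    proof (cases "h = 0")
      case False
      then have h: "h \<in> Kx" using h by simp
      show ?thesis
        unfolding twistD[OF twist_power[OF twist_X[OF assms], of n] h] period[OF h] ..
    qed simp
  qed
  then have "w ^ n \<in> Kx" using X_nz[OF assms] by simp
  then show ?thesis using Fx_commute[OF assms, of "w ^ n"] by (simp only: power_commutes)
qed

lemma one_in_Fx: "1 \<in> Fx"
  by (simp add: Fx_def one_mem)

definition orbit :: "'a \<Rightarrow> 'a set" where "orbit w = (\<lambda>c. c * w * inverse c) ` Kx"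

text \<open>Orbit-stabilizer: \<open>Fx\<close> is the stabilizer of \<open>w\<close> under
  conjugation by \<open>Kx\<close>.\<close>

lemma card_orbit:
  assumes w: "w \<in> X"
  shows "card Kx = card (orbit w) * card Fx"
  unfolding orbit_def
proof (rule card_eq_card_image_times_fibre)
  fix z assume "z \<in> (\<lambda>c. c * w * inverse c) ` Kx"
  then obtain c0 where c0: "c0 \<in> Kx" and z: "z = c0 * w * inverse c0" by blast
  have iff: "c * w * inverse c = z \<longleftrightarrow> inverse c0 * c \<in> Fx" if c: "c \<in> Kx" for c
  proof -
    have "c * w * inverse c = z \<longleftrightarrow> c * w = z * c"
      using c by (simp add: conjugate_eq_iff)
    also have "\<dots> \<longleftrightarrow> inverse c0 * (c * w) = inverse c0 * (z * c)"
      using c0 by simp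
    also have "inverse c0 * (z * c) = w * (inverse c0 * c)"
      using c0 z by (simp add: mult.assoc[symmetric])
    also have "inverse c0 * (c * w) = w * (inverse c0 * c) \<longleftrightarrow> inverse c0 * c \<in> Fx"
      using Fx_commute[OF w, of "inverse c0 * c"] c c0
      by (auto simp: mult_mem inverse_mem mult.assoc)
    finally show ?thesis .
  qed
  have "{c \<in> Kx. c * w * inverse c = z} = (\<lambda>d. c0 * d) ` Fx"
  proof (intro equalityI subsetI)
    fix c assume "c \<in> {c \<in> Kx. c * w * inverse c = z}"
    then have "inverse c0 * c \<in> Fx" using iff by auto
    then show "c \<in> (\<lambda>d. c0 * d) ` Fx"
      using c0 by (intro image_eqI[of _ _ "inverse c0 * c"]) (auto simp: mult.assoc[symmetric])
  next
    fix c assume "c \<in> (\<lambda>d. c0 * d) ` Fx"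
    then obtain d where d: "d \<in> Fx" "c = c0 * d" by blast
    then have "c \<in> Kx" using c0 by (auto simp: Fx_def mult_mem)
    moreover have "inverse c0 * c \<in> Fx" using c0 d by (simp add: mult.assoc[symmetric])
    ultimately show "c \<in> {c \<in> Kx. c * w * inverse c = z}" using iff by simp
  qed
  also have "card \<dots> = card Fx" using c0 by (intro card_image inj_onI) auto
  finally show "card {c \<in> Kx. c * w * inverse c = z} = card Fx" .
qed simp

text \<open>The intertwiner \<open>\<Sum>i<n. w'\<^sup>i \<theta> w\<^sup>-\<^sup>i\<close> plays the role of the resolvent in Hilbert's Theorem 90.\<close>

lemma mem_orbit_if_power_eq:
  assumes w: "w \<in> X" and w': "w' \<in> X" and eq: "w' ^ n = w ^ n"
  shows "w' \<in> orbit w"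
proof -
  define N where "N i = w' ^ i * inverse (w ^ i)" for i
  define c where "c \<theta> = (\<Sum>i<n. w' ^ i * \<theta> * inverse (w ^ i))" for \<theta>
  have N: "N i \<in> K" for i
    unfolding N_def
    by (rule twist_quotient_mem) (use twist_power twist_X X_nz w w' in auto)
  have trm: "w' ^ i * \<theta> * inverse (w ^ i) = \<theta> ^ (j ^ i) * N i" if "\<theta> \<in> Kx" for \<theta> i
    using twistD[OF twist_power[OF twist_X[OF w']] that, of i] by (simp add: N_def mult.assoc)
  have c_mem: "c \<theta> \<in> K" if "\<theta> \<in> Kx" for \<theta>
    unfolding c_def using that by (intro sum_mem) (simp add: trm mult_mem power_mem N)
  \<comment> \<open>The two outer factors shift the summation index by one, and the end terms agree
    because \<open>w' ^ n = w ^ n\<close> commutes with \<open>\<theta>\<close>.\<close>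
  have comm: "w' * c \<theta> * inverse w = c \<theta>" if "\<theta> \<in> Kx" for \<theta>
  proof -
    let ?t = "\<lambda>i. w' ^ i * \<theta> * inverse (w ^ i)"
    have "w' * ?t i * inverse w = ?t (Suc i)" for i
      using X_nz[OF w] by (simp add: mult.assoc nonzero_inverse_mult_distrib)
    then have "w' * c \<theta> * inverse w = (\<Sum>i<n. ?t (Suc i))"
      by (simp only: c_def sum_distrib_left sum_distrib_right)
    moreover have "?t n = ?t 0"
    proof -
      have "w ^ n * \<theta> = \<theta> * w ^ n"
        using power_n_mem[OF w] that by (intro commute) (auto simp: Fx_def)
      then show ?thesis using X_nz[OF w] eq by (simp add: mult.assoc)
    qed
    moreover have "(\<Sum>i<n. ?t (Suc i)) + ?t 0 = (\<Sum>i<n. ?t i) + ?t n"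
      using sum.lessThan_Suc[of ?t n] sum.lessThan_Suc_shift[of ?t n] by (simp only: add.commute)
    ultimately show ?thesis by (simp add: c_def)
  qed
  have "\<exists>\<theta>\<in>Kx. c \<theta> \<noteq> 0"
  proof (rule ccontr)
    assume "\<not> ?thesis"
    \<comment> \<open>With the weights \<open>inverse \<theta>\<close>, orthogonality isolates the
      term \<open>i = 0\<close>, and \<open>N 0 = 1\<close>.\<close>
    then have "0 = (\<Sum>\<theta>\<in>Kx. inverse \<theta> * c \<theta>)" by simp
    also have "\<dots> = (\<Sum>\<theta>\<in>Kx. \<Sum>i<n. \<theta> ^ (j ^ i) * inverse \<theta> * N i)"
    proof (rule sum.cong)
      fix \<theta> assume \<theta>: "\<theta> \<in> Kx"
      have "inverse \<theta> * \<theta> ^ (j ^ i) = \<theta> ^ (j ^ i) * inverse \<theta>" for i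
        using \<theta> by (intro commute) (auto simp: power_mem inverse_mem)
      then show "inverse \<theta> * c \<theta> = (\<Sum>i<n. \<theta> ^ (j ^ i) * inverse \<theta> * N i)"
        unfolding c_def sum_distrib_left using trm[OF \<theta>]
        by (intro sum.cong refl) (simp only: mult.assoc[symmetric])
    qed simp
    also have "\<dots> = (\<Sum>i<n. \<Sum>\<theta>\<in>Kx. \<theta> ^ (j ^ i) * inverse \<theta> * N i)" by (rule sum.swap)
    also have "\<dots> = (\<Sum>i<n. if i = 0 then - N i else 0)"
      unfolding sum_distrib_right[symmetric] by (intro sum.cong) (auto simp: sum_character)
    also have "\<dots> = (if 0 \<in> {..<n} then - N 0 else 0)" by (rule sum.delta) simp
    also have "\<dots> = - N 0" using n_pos by simp
    also have "\<dots> = - 1" by (simp add: N_def)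
    finally show False by simp
  qed
  then obtain \<theta> where \<theta>: "\<theta> \<in> Kx" "c \<theta> \<noteq> 0" by blast
  have "w' * c \<theta> = w' * c \<theta> * inverse w * w"
    using X_nz[OF w] by (simp add: mult.assoc)
  then have "c \<theta> * w = w' * c \<theta>" using comm[OF \<theta>(1)] by simp
  then have "c \<theta> * w * inverse (c \<theta>) = w'"
    using conjugate_eq_iff[OF \<theta>(2)] by blast
  then show ?thesis unfolding orbit_def using \<theta> c_mem by blast
qed

text \<open>If the value 1 were missed, at most \<open>card Fx - 1\<close> values would occur, each
  on at most one orbit of size \<open>card Kx / card Fx\<close>; these are too few elements to fill
  \<open>X\<close>.\<close>

lemma ex_power_eq_1: "\<exists>w\<in>X. w ^ n = 1"
proof (rule ccontr)
  assume none: "\<not> ?thesis"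
  have y: "y \<in> X" unfolding X_def using one_mem by (intro image_eqI[of _ _ 1]) auto
  define s where "s = card (orbit y)"
  have Kx: "card Kx = s * card Fx" using card_orbit[OF y] by (simp add: s_def)
  have Fx: "card Fx > 0" using one_in_Fx by (auto simp: card_gt_0_iff)
  have Kx_pos: "card Kx > 0" using one_mem by (auto simp: card_gt_0_iff)
  have orbit: "card (orbit w) = s" if "w \<in> X" for w
    using card_orbit[OF that] Kx Fx by (metis mult_right_cancel less_not_refl)
  have fibre: "card {w \<in> X. w ^ n = z} \<le> s" if z: "z \<in> (\<lambda>w. w ^ n) ` X" for z
  proof -
    from z obtain w where w: "w \<in> X" "z = w ^ n" by blast
    have "{w' \<in> X. w' ^ n = z} \<subseteq> orbit w" using mem_orbit_if_power_eq w by blast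
    then show ?thesis using orbit[OF w(1)] by (metis card_mono finite)
  qed
  have sub: "(\<lambda>w. w ^ n) ` X \<subseteq> Fx - {1}" using none power_n_mem by auto
  have "card Kx = card (\<Union>z\<in>(\<lambda>w. w ^ n) ` X. {w \<in> X. w ^ n = z})"
    unfolding card_X[symmetric] by (rule arg_cong[of _ _ card]) auto
  also have "\<dots> \<le> (\<Sum>z\<in>(\<lambda>w. w ^ n) ` X. card {w \<in> X. w ^ n = z})"
    by (intro card_UN_le) simp
  also have "\<dots> \<le> (\<Sum>z\<in>(\<lambda>w. w ^ n) ` X. s)" by (intro sum_mono fibre)
  also have "\<dots> \<le> card (Fx - {1}) * s" using card_mono[OF _ sub] by simp
  also have "\<dots> < card Fx * s"
    using Kx Kx_pos Fx one_in_Fx by (simp add: card_Diff_singleton)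
  finally show False using Kx by (simp add: mult.commute)
qed

lemma n_eq_1: "n = 1"
proof (rule ccontr)
  assume "n \<noteq> 1"
  obtain w where w: "w \<in> X" "w ^ n = 1" using ex_power_eq_1 by blast
  from \<open>n \<noteq> 1\<close> n_pos have "1 < n" by simp
  then obtain h where h: "h \<in> Kx" "h ^ j \<noteq> h" using n_minimal[of 1] by auto
  have "w \<noteq> 1" using twistD[OF twist_X[OF w(1)] h(1)] h(2) by auto
  then have "(\<Sum>i<n. w ^ i) = 0"
    using geometric_sum_ring_1[of w n] w(2) by simp
  then have "w ^ 0 = 0"
    by (intro twist_sum_eq_0[of "\<lambda>i. w ^ i"] twist_power twist_X w)
  then show False by simp
qed

end

theorem wedderburn_little:
  fixes a b :: "'a::{division_ring,finite}"
  shows "a * b = b * a"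
proof -
  define P where "P K \<longleftrightarrow> (\<forall>x\<in>K. \<forall>y\<in>K. x * y = y * x)" for K :: "'a set"
  have "\<exists>K. P K \<and> a \<in> K \<and> (\<forall>L. P L \<and> a \<in> L \<longrightarrow> K \<subseteq> L \<longrightarrow> L = K)"
  proof -
    have "{a} \<in> {K. P K \<and> a \<in> K}" by (simp add: P_def)
    from finite_has_maximal2[OF _ this] obtain K
      where "P K" "a \<in> K" "\<forall>L\<in>{K. P K \<and> a \<in> K}. K \<subseteq> L \<longrightarrow> K = L" by auto
    then show ?thesis by (intro exI[of _ K]) auto
  qed
  then obtain K where K: "P K" "a \<in> K" and max: "\<And>L. P L \<Longrightarrow> a \<in> L \<Longrightarrow> K \<subseteq> L \<Longrightarrow> L = K"
    by blast
  interpret maximal_commuting_set K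
  proof
    show "x * y = y * x" if "x \<in> K" "y \<in> K" for x y using K that by (auto simp: P_def)
    show "x \<in> K" if "\<And>y. y \<in> K \<Longrightarrow> x * y = y * x" for x
    proof -
      have "P (insert x K)" using K(1) that by (auto simp: P_def)
      then have "insert x K = K" using K by (intro max) auto
      then show ?thesis by blast
    qed
  qed
  have "x \<in> K" for x
  proof (rule ccontr)
    assume "x \<notin> K"
    then obtain j y where y: "twist j y" "y \<notin> K" by (rule ex_twist_not_mem)
    have y_nz: "y \<noteq> 0" using y(2) zero_mem by auto
    have period_iff: "h ^ (j ^ i) = h \<longleftrightarrow> y ^ i * h = h * y ^ i" if "h \<in> Kx" for h i
      using twistD[OF twist_power[OF y(1)] that, of i] y_nz by auto
    let ?Q = "\<lambda>i. 0 < i \<and> (\<forall>h\<in>Kx. h ^ (j ^ i) = h)"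
    \<comment> \<open>Makes \<open>card UNIV - 1\<close> positive, so that it is a period and the
      least period exists.\<close>
    have "card {0::'a, 1} \<le> card (UNIV :: 'a set)" by (intro card_mono) auto
    then have "?Q (card (UNIV :: 'a set) - 1)"
      using period_iff power_card_minus_1_eq_1[OF y_nz] by simp
    then have least: "?Q (LEAST i. ?Q i)" by (rule LeastI)
    have "cyclic_twist K y j (LEAST i. ?Q i)"
    proof unfold_locales
      fix i assume "0 < i" "i < (LEAST i. ?Q i)"
      then show "\<exists>h\<in>Kx. h ^ (j ^ i) \<noteq> h" using not_less_Least[of i ?Q] by blast
    qed (use y y_nz least in auto)
    then have "(LEAST i. ?Q i) = 1" by (rule cyclic_twist.n_eq_1)
    \<comment> \<open>Period 1 means that \<open>y\<close> centralizes \<open>K\<close>, which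
      contradicts \<open>y \<notin> K\<close>.\<close>
    then have "h ^ j = h" if "h \<in> Kx" for h using least that by simp
    then have "y * h = h * y" if "h \<in> K" for h
      using period_iff[of h 1] that by (cases "h = 0") auto
    then show False using maximal y(2) by blast
  qed
  then show ?thesis using commute by blast
qed


section \<open>The residue division ring of a finite local ring\<close>

text \<open>Both multiplications by \<open>a\<close> are injective, hence surjective by finiteness,
  and the resulting one-sided inverses coincide.\<close>

lemma unit_if_not_zero_divisor:
  fixes a :: "'a::{ring_1,finite}"
  assumes "\<not> zero_divisor a"
  obtains b where "a * b = 1" "b * a = 1"
proof -
  have l: "inj (\<lambda>x. a * x)"
  proof (rule injI)
    fix x y assume "a * x = a * y"
    then have "a * (x - y) = 0" by (simp add: algebra_simps)
    then have "x - y = 0" using assms unfolding zero_divisor_def by blast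
    then show "x = y" by simp
  qed
  have r: "inj (\<lambda>x. x * a)"
  proof (rule injI)
    fix x y assume "x * a = y * a"
    then have "(x - y) * a = 0" by (simp add: algebra_simps)
    then have "x - y = 0" using assms unfolding zero_divisor_def by blast
    then show "x = y" by simp
  qed
  obtain b where b: "a * b = 1" using finite_UNIV_inj_surj[OF _ l] by (metis finite surjD)
  obtain c where c: "c * a = 1" using finite_UNIV_inj_surj[OF _ r] by (metis finite surjD)
  have "b = c" using b c by (metis mult.assoc mult_1_left mult_1_right)
  with b c that show thesis by blast
qed

context finite_local_ring
begin

lemma zero_divisor_0: "zero_divisor 0"
  and zero_divisor_add: "zero_divisor a \<Longrightarrow> zero_divisor b \<Longrightarrow> zero_divisor (a + b)"
  and zero_divisor_mult_left: "zero_divisor a \<Longrightarrow> zero_divisor (r * a)"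
  and zero_divisor_mult_right: "zero_divisor a \<Longrightarrow> zero_divisor (a * r)"
  using zero_divisors_ideal by (auto simp: two_sided_ideal_def left_ideal_def right_ideal_def)

lemma zero_divisor_uminus: "zero_divisor a \<Longrightarrow> zero_divisor (- a)"
  using zero_divisor_mult_left[of a "- 1"] by simp

lemma zero_divisor_diff: "zero_divisor a \<Longrightarrow> zero_divisor b \<Longrightarrow> zero_divisor (a - b)"
  using zero_divisor_add[of a "- b"] zero_divisor_uminus[of b] by simp

lemma not_zero_divisor_1: "\<not> zero_divisor 1"
  by (simp add: zero_divisor_def)

end

quotient_type (overloaded) 'a residue = "'a::finite_local_ring" / "\<lambda>x y. zero_divisor (x - y)"
proof (rule equivpI)
  show "reflp (\<lambda>x y :: 'a. zero_divisor (x - y))"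
    by (rule reflpI) (simp add: zero_divisor_0)
  show "symp (\<lambda>x y :: 'a. zero_divisor (x - y))"
  proof (rule sympI)
    fix x y :: 'a
    assume "zero_divisor (x - y)"
    then show "zero_divisor (y - x)" using zero_divisor_uminus[of "x - y"] by simp
  qed
  show "transp (\<lambda>x y :: 'a. zero_divisor (x - y))"
  proof (rule transpI)
    fix x y z :: 'a
    assume "zero_divisor (x - y)" "zero_divisor (y - z)"
    then show "zero_divisor (x - z)" using zero_divisor_add[of "x - y" "y - z"] by simp
  qed
qed

instantiation residue :: (finite_local_ring) ring_1
begin

lift_definition zero_residue :: "'a residue" is 0 .
lift_definition one_residue :: "'a residue" is 1 .
lift_definition plus_residue :: "'a residue \<Rightarrow> 'a residue \<Rightarrow> 'a residue" is "(+)"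
  by (simp add: add_diff_add zero_divisor_add)
lift_definition minus_residue :: "'a residue \<Rightarrow> 'a residue \<Rightarrow> 'a residue" is "(-)"
proof -
  fix a a' b b' :: 'a
  assume "zero_divisor (a - a')" "zero_divisor (b - b')"
  then have "zero_divisor ((a - a') - (b - b'))" by (rule zero_divisor_diff)
  then show "zero_divisor ((a - b) - (a' - b'))" by (simp add: algebra_simps)
qed
lift_definition uminus_residue :: "'a residue \<Rightarrow> 'a residue" is uminus
  by (simp only: minus_diff_minus zero_divisor_uminus)
lift_definition times_residue :: "'a residue \<Rightarrow> 'a residue \<Rightarrow> 'a residue" is "(*)"
proof -
  fix a a' b b' :: 'a
  assume "zero_divisor (a - a')" "zero_divisor (b - b')"
  then have "zero_divisor ((a - a') * b + a' * (b - b'))"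
    by (intro zero_divisor_add zero_divisor_mult_left zero_divisor_mult_right)
  then show "zero_divisor (a * b - a' * b')" by (simp add: algebra_simps)
qed

instance
proof
  fix a b c :: "'a residue"
  show "a + b + c = a + (b + c)" by transfer (simp add: add.assoc zero_divisor_0)
  show "a + b = b + a" by transfer (simp add: add.commute zero_divisor_0)
  show "0 + a = a" by transfer (simp add: zero_divisor_0)
  show "- a + a = 0" by transfer (simp add: zero_divisor_0)
  show "a - b = a + - b" by transfer (simp add: zero_divisor_0)
  show "a * b * c = a * (b * c)" by transfer (simp add: mult.assoc zero_divisor_0)
  show "(a + b) * c = a * c + b * c" by transfer (simp add: distrib_right zero_divisor_0)
  show "a * (b + c) = a * b + a * c" by transfer (simp add: distrib_left zero_divisor_0)
  show "1 * a = a" "a * 1 = a" by (transfer, simp add: zero_divisor_0)+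
  show "(0 :: 'a residue) \<noteq> 1"
    by transfer (use zero_divisor_uminus not_zero_divisor_1 in fastforce)
qed

end

lemmas abs_residue_hom =
  zero_residue.abs_eq[symmetric] one_residue.abs_eq[symmetric] plus_residue.abs_eq[symmetric]
  minus_residue.abs_eq[symmetric] times_residue.abs_eq[symmetric]

lemma abs_residue_eq_iff: "abs_residue x = abs_residue y \<longleftrightarrow> zero_divisor (x - y)"
  by (rule residue.abs_eq_iff)

lemma abs_residue_eq_0_iff: "abs_residue x = 0 \<longleftrightarrow> zero_divisor x"
  by (simp add: zero_residue.abs_eq abs_residue_eq_iff)

lemma surj_abs_residue: "surj abs_residue"
  by (metis surjI Quotient_abs_rep[OF Quotient_residue])

lemma abs_residue_power: "abs_residue (x ^ n) = abs_residue x ^ n"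
  by (induction n) (simp_all add: abs_residue_hom)

lemma abs_residue_sum: "abs_residue (sum g A) = (\<Sum>i\<in>A. abs_residue (g i))"
  by (induction A rule: infinite_finite_induct) (simp_all add: abs_residue_hom)

instance residue :: (finite_local_ring) finite
proof
  show "finite (UNIV :: 'a residue set)"
    unfolding surj_abs_residue[symmetric] by simp
qed

lemma residue_inverse:
  assumes "(x :: 'a::finite_local_ring residue) \<noteq> 0"
  shows "\<exists>y. x * y = 1 \<and> y * x = 1"
proof -
  obtain a where x: "x = abs_residue a" by (metis surjD surj_abs_residue)
  then have "\<not> zero_divisor a" using assms by (simp add: abs_residue_eq_0_iff)
  then obtain b where "a * b = 1" "b * a = 1" by (rule unit_if_not_zero_divisor)
  then have "abs_residue a * abs_residue b = 1" "abs_residue b * abs_residue a = 1"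
    by (simp_all flip: abs_residue_hom)
  then show ?thesis unfolding x by blast
qed

instantiation residue :: (finite_local_ring) division_ring
begin

definition inverse_residue :: "'a residue \<Rightarrow> 'a residue" where
  "inverse_residue x = (if x = 0 then 0 else SOME y. x * y = 1 \<and> y * x = 1)"

definition divide_residue :: "'a residue \<Rightarrow> 'a residue \<Rightarrow> 'a residue" where
  "divide_residue x y = x * inverse y" for x y :: "'a residue"

instance
proof
  fix a b :: "'a residue"
  assume "a \<noteq> 0"
  then have "a * inverse a = 1 \<and> inverse a * a = 1"
    using someI_ex[OF residue_inverse, of a] by (simp only: inverse_residue_def if_False not_False_eq_True)
  then show "inverse a * a = 1" "a * inverse a = 1" by auto
qed (simp_all add: inverse_residue_def divide_residue_def)

end


section \<open>Derivatives of polynomials with noncommuting coefficients\<close>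

text \<open>The part of \<open>(a + b) ^ n\<close> that is linear in \<open>b\<close>.\<close>

primrec power_deriv :: "'a::ring_1 \<Rightarrow> 'a \<Rightarrow> nat \<Rightarrow> 'a" where
  "power_deriv a b 0 = 0"
| "power_deriv a b (Suc n) = a * power_deriv a b n + b * a ^ n"

definition poly_deriv :: "'a::ring_1 poly \<Rightarrow> 'a \<Rightarrow> 'a \<Rightarrow> 'a" where
  "poly_deriv f a b = (\<Sum>i\<le>degree f. coeff f i * power_deriv a b i)"

text \<open>The sum of \<open>a ^ j * a' ^ (n - 1 - j)\<close> over \<open>j < n\<close>, with the
  powers of \<open>a\<close> kept on the left.\<close>

primrec power_diff_quot :: "'a::ring_1 \<Rightarrow> 'a \<Rightarrow> nat \<Rightarrow> 'a" where
  "power_diff_quot a a' 0 = 0"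
| "power_diff_quot a a' (Suc n) = a * power_diff_quot a a' n + a' ^ n"

definition poly_diff_quot :: "'a::ring_1 poly \<Rightarrow> 'a \<Rightarrow> 'a \<Rightarrow> 'a" where
  "poly_diff_quot f a a' = (\<Sum>i\<le>degree f. coeff f i * power_diff_quot a a' i)"

lemma sum_degree_bound:
  assumes "degree f \<le> n"
  shows "(\<Sum>i\<le>degree f. coeff f i * g i) = (\<Sum>i\<le>n. coeff f i * (g i :: 'a::ring_1))"
  using assms by (intro sum.mono_neutral_left) (auto simp: coeff_eq_0)

lemma power_deriv_add: "power_deriv a (b + c) n = power_deriv a b n + power_deriv a c n"
  by (induction n) (simp_all add: algebra_simps)

lemma poly_deriv_add: "poly_deriv f a (b + c) = poly_deriv f a b + poly_deriv f a c"
  by (simp add: poly_deriv_def power_deriv_add distrib_left sum.distrib)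

lemma inj_poly_deriv_iff: "inj (poly_deriv f a) \<longleftrightarrow> (\<forall>b. poly_deriv f a b = 0 \<longrightarrow> b = 0)"
proof
  have zero: "poly_deriv f a 0 = 0" using poly_deriv_add[of f a 0 0] by simp
  show "\<forall>b. poly_deriv f a b = 0 \<longrightarrow> b = 0" if "inj (poly_deriv f a)"
    using injD[OF that, of _ 0] zero by simp
  assume kernel: "\<forall>b. poly_deriv f a b = 0 \<longrightarrow> b = 0"
  show "inj (poly_deriv f a)"
  proof (rule injI)
    fix b c assume "poly_deriv f a b = poly_deriv f a c"
    then have "poly_deriv f a (b - c) = 0" using poly_deriv_add[of f a "b - c" c] by simp
    then show "b = c" using kernel by auto
  qed
qed

lemma power_deriv_central_mult:
  assumes "\<And>x. q * x = x * q"
  shows "power_deriv a (q * r) n = q * power_deriv a r n"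
proof (induction n)
  case (Suc n)
  have "a * (q * z) = q * (a * z)" for z by (metis assms mult.assoc)
  with Suc show ?case by (simp add: algebra_simps)
qed simp

lemma poly_deriv_central_mult:
  assumes "\<And>x. q * x = x * q"
  shows "poly_deriv f a (q * r) = q * poly_deriv f a r"
proof -
  have "c * (q * z) = q * (c * z)" for c z by (metis assms mult.assoc)
  then show ?thesis
    by (simp add: poly_deriv_def power_deriv_central_mult[OF assms] sum_distrib_left)
qed

text \<open>The hypothesis kills every word of the expansion that contains \<open>y\<close> at least
  twice.\<close>

lemma power_add_square_zero:
  fixes a y :: "'a::ring_1"
  assumes "\<And>x. y * x * y = 0"
  shows "(a + y) ^ n = a ^ n + power_deriv a y n"
proof -
  have z: "y * power_deriv a y n = 0" for n
  proof -
    \<comment> \<open>The arbitrary \<open>x\<close> absorbs the factors \<open>a\<close> that the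
      recursion places after the first \<open>y\<close>.\<close>
    have "y * x * power_deriv a y n = 0" for x
    proof (induction n arbitrary: x)
      case (Suc n)
      then show ?case using Suc[of "x * a"] assms[of x]
        by (simp add: algebra_simps) (simp add: mult.assoc[symmetric])
    qed simp
    from this[of 1] show ?thesis by simp
  qed
  show ?thesis by (induction n) (simp_all add: algebra_simps z)
qed

lemma right_subst_add_square_zero:
  assumes "\<And>x. y * x * y = 0"
  shows "right_subst f (a + y) = right_subst f a + poly_deriv f a y"
  by (simp add: right_subst_def poly_deriv_def power_add_square_zero[OF assms]
      distrib_left sum.distrib)

text \<open>Moving \<open>b\<close> to the right past a power of \<open>a\<close> turns it into the
  same power of \<open>a'\<close>.\<close>

lemma power_deriv_eq_diff_quot_mult:
  assumes "b * a = a' * b"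
  shows "power_deriv a b n = power_diff_quot a a' n * b"
proof (induction n)
  case (Suc n)
  have "b * a ^ n = a' ^ n * b"
  proof (induction n)
    case (Suc n)
    have "b * a ^ Suc n = (b * a) * a ^ n" by (simp add: mult.assoc)
    also have "\<dots> = a' * (b * a ^ n)" by (simp only: assms mult.assoc)
    finally show ?case using Suc by (simp add: mult.assoc)
  qed simp
  with Suc show ?case by (simp add: algebra_simps)
qed simp

lemma poly_deriv_eq_diff_quot_mult:
  assumes "b * a = a' * b"
  shows "poly_deriv f a b = poly_diff_quot f a a' * b"
  by (simp add: poly_deriv_def poly_diff_quot_def power_deriv_eq_diff_quot_mult[OF assms]
      sum_distrib_right mult.assoc)

section \<open>Polynomial functions on the dual numbers\<close>

lemma Dual_power: "Dual a v ^ n = Dual (a ^ n) (\<lambda>i. power_deriv a (v i) n)"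
  by (induction n) (simp_all add: one_dual_def times_dual_def)

lemma right_subst_dual:
  fixes f0 :: "'a::ring_1 poly" and fs :: "'k::finite \<Rightarrow> 'a poly"
  shows "right_subst (dual_poly f0 + (\<Sum>i\<in>UNIV. poly_mult_const (dual_poly (fs i)) (dual_var i)))
      (Dual a v) =
    Dual (right_subst f0 a) (\<lambda>i. poly_deriv f0 a (v i) + right_subst (fs i) a)"
proof -
  let ?f = "dual_poly f0 + (\<Sum>i\<in>UNIV. poly_mult_const (dual_poly (fs i)) (dual_var i))"
  \<comment> \<open>A common bound on all the degrees, so that one summation range serves
    \<open>?f\<close>, \<open>f0\<close> and every \<open>fs j\<close>.\<close>
  define n where "n = degree ?f + degree f0 + (\<Sum>i\<in>UNIV. degree (fs i))"
  have coeff: "coeff ?f i = Dual (coeff f0 i) (\<lambda>j. coeff (fs j) i)" for i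
    by (simp add: coeff_sum coeff_poly_mult_const coeff_dual_poly dual_basis)
  have deg: "degree ?f \<le> n" "degree f0 \<le> n" "degree (fs j) \<le> n" for j
    using member_le_sum[of j UNIV "\<lambda>i. degree (fs i)"] by (simp_all add: n_def)
  have "right_subst ?f (Dual a v) = (\<Sum>i\<le>n. coeff ?f i * Dual a v ^ i)"
    unfolding right_subst_def by (rule sum_degree_bound[OF deg(1)])
  also have "\<dots> = (\<Sum>i\<le>n. Dual (coeff f0 i * a ^ i)
      (\<lambda>j. coeff f0 i * power_deriv a (v j) i + coeff (fs j) i * a ^ i))"
    by (simp only: coeff Dual_power times_dual_def dual.sel)
  also have "\<dots> = Dual (\<Sum>i\<le>n. coeff f0 i * a ^ i) (\<lambda>j. (\<Sum>i\<le>n. coeff f0 i * power_deriv a (v j) i)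
      + (\<Sum>i\<le>n. coeff (fs j) i * a ^ i))"
    by (intro dual.expand) (simp add: const_part_sum dual_part_sum fun_eq_iff sum.distrib)
  also have "\<dots> = Dual (right_subst f0 a) (\<lambda>i. poly_deriv f0 a (v i) + right_subst (fs i) a)"
    unfolding right_subst_def poly_deriv_def
    by (simp only: sum_degree_bound[OF deg(2)] sum_degree_bound[OF deg(3)])
  finally show ?thesis .
qed

text \<open>Over a fixed \<open>a\<close> each dual coordinate undergoes
  \<open>poly_deriv f0 a\<close> followed by a translation, so injectivity there is that of
  \<open>poly_deriv f0 a\<close>.\<close>

lemma permutation_poly_dual_iff:
  fixes f0 :: "'a::{ring_1,finite} poly" and fs :: "'k::finite \<Rightarrow> 'a poly"
  shows "permutation_poly (dual_poly f0 + (\<Sum>i\<in>UNIV. poly_mult_const (dual_poly (fs i)) (dual_var i)))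
    \<longleftrightarrow> permutation_poly f0 \<and> (\<forall>a. inj (poly_deriv f0 a))"
    (is "permutation_poly ?f \<longleftrightarrow> _")
proof
  assume "permutation_poly ?f"
  then have bij: "bij (right_subst ?f)" by (simp add: permutation_poly_def)
  have "surj (right_subst f0)"
    unfolding surj_def
  proof
    fix c
    obtain x where x: "Dual c (\<lambda>_. 0) = right_subst ?f x"
      using surjD[OF bij_is_surj[OF bij]] by blast
    obtain a v where "x = Dual a v" by (cases x)
    then have "c = right_subst f0 a" using x by (simp only: right_subst_dual dual.inject)
    then show "\<exists>a. c = right_subst f0 a" ..
  qed
  moreover have "inj (poly_deriv f0 a)" for a
  proof (rule injI)
    fix b b' assume "poly_deriv f0 a b = poly_deriv f0 a b'"
    then have "right_subst ?f (Dual a (\<lambda>_. b)) = right_subst ?f (Dual a (\<lambda>_. b'))"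
      by (simp only: right_subst_dual)
    then have "Dual a (\<lambda>_ :: 'k. b) = Dual a (\<lambda>_. b')"
      by (rule injD[OF bij_is_inj[OF bij]])
    then show "b = b'" by (simp add: fun_eq_iff)
  qed
  ultimately show "permutation_poly f0 \<and> (\<forall>a. inj (poly_deriv f0 a))"
    by (simp add: permutation_poly_def bij_def finite_UNIV_surj_inj)
next
  assume f0: "permutation_poly f0 \<and> (\<forall>a. inj (poly_deriv f0 a))"
  have "inj (right_subst ?f)"
  proof (rule injI)
    fix x y assume eq: "right_subst ?f x = right_subst ?f y"
    obtain a v b w where xy: "x = Dual a v" "y = Dual b w" by (cases x, cases y)
    have "right_subst f0 a = right_subst f0 b"
      and deriv: "poly_deriv f0 a (v i) + right_subst (fs i) a =
        poly_deriv f0 b (w i) + right_subst (fs i) b" for i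
      using eq by (simp_all only: xy right_subst_dual dual.inject) (metis (full_types))
    then have "a = b" using f0 by (simp add: permutation_poly_def bij_def inj_eq)
    moreover have "v = w"
    proof
      fix i
      have "poly_deriv f0 a (v i) = poly_deriv f0 a (w i)"
        using deriv[of i] \<open>a = b\<close> by simp
      then show "v i = w i" using f0 by (simp add: inj_eq)
    qed
    ultimately show "x = y" by (simp add: xy)
  qed
  then show "permutation_poly ?f"
    by (simp add: permutation_poly_def bij_def finite_UNIV_inj_surj)
qed


section \<open>Finite chain rings\<close>

text \<open>For a unit \<open>u\<close> the left ideals \<open>L\<close> and \<open>L u\<close> have the same size, so they coincide in a chain.\<close>

lemma principal_left_ideal_two_sided:
  fixes b a :: "'a::finite_chain_ring"
  obtains a' where "b * a = a' * b"
proof -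
  let ?L = "range (\<lambda>r. r * b)"
  have L: "left_ideal ?L"
    unfolding left_ideal_def
    by (auto simp: image_iff mult.assoc[symmetric]) (metis mult_zero_left, metis distrib_right)
  have unit: "b * u \<in> ?L" if u: "\<not> zero_divisor u" for u
  proof -
    obtain v where v: "u * v = 1" "v * u = 1" by (rule unit_if_not_zero_divisor[OF u])
    let ?Lu = "(\<lambda>x. x * u) ` ?L"
    have "left_ideal ?Lu"
      unfolding left_ideal_def image_image
      by (auto simp: image_iff mult.assoc[symmetric]) (metis mult_zero_left, metis distrib_right)
    moreover have "inj (\<lambda>x. x * u)"
      by (rule injI) (metis v(1) mult.assoc mult_1_right)
    then have "card ?Lu = card ?L" by (metis card_image inj_on_subset subset_UNIV)
    ultimately have "?Lu = ?L"
      using left_ideals_chain[OF L, of ?Lu] by (metis card_subset_eq finite)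
    moreover have "b * u \<in> ?Lu" by (auto simp: image_iff intro!: exI[of _ 1])
    ultimately show ?thesis by simp
  qed
  have "b * a \<in> ?L"
  proof (cases "zero_divisor a")
    case True
    \<comment> \<open>A non-unit \<open>a\<close> is traded for the unit \<open>1 + a\<close>, at
      the cost of subtracting \<open>b\<close>.\<close>
    have "\<not> zero_divisor (1 + a)"
      using zero_divisor_diff[of "1 + a" a] True not_zero_divisor_1 by auto
    then obtain r where "b * (1 + a) = r * b" using unit by blast
    then have "b * a = (r - 1) * b" by (simp add: algebra_simps)
    then show ?thesis by blast
  qed (rule unit)
  then show thesis using that by blast
qed

section \<open>Reduction of difference quotients to the residue field\<close>

lemma abs_residue_right_subst:
  "abs_residue (right_subst f a) = (\<Sum>i\<le>degree f. abs_residue (coeff f i) * abs_residue a ^ i)"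
  by (simp add: abs_residue_hom right_subst_def abs_residue_sum abs_residue_power)

lemma abs_residue_power_diff_quot:
  "abs_residue (power_diff_quot a a' n) = power_diff_quot (abs_residue a) (abs_residue a') n"
  by (induction n) (simp_all add: abs_residue_hom abs_residue_power)

lemma abs_residue_power_deriv:
  "abs_residue (power_deriv a b n) = power_deriv (abs_residue a) (abs_residue b) n"
  by (induction n) (simp_all add: abs_residue_hom abs_residue_power)

lemma abs_residue_poly_diff_quot:
  "abs_residue (poly_diff_quot f a a') =
    (\<Sum>i\<le>degree f. abs_residue (coeff f i) * power_diff_quot (abs_residue a) (abs_residue a') i)"
  by (simp add: abs_residue_hom poly_diff_quot_def abs_residue_sum abs_residue_power_diff_quot)

lemma power_diff_quot_mult_diff:
  assumes "a * a' = a' * a"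
  shows "power_diff_quot a a' n * (a - a') = a ^ n - a' ^ n"
proof (induction n)
  case (Suc n)
  have "a' ^ n * a = a * a' ^ n"
    using power_commuting_commutes[of a' a n] assms by simp
  then have "power_diff_quot a a' (Suc n) * (a - a') =
      a * (power_diff_quot a a' n * (a - a')) + (a * a' ^ n - a' ^ n * a')"
    by (simp add: algebra_simps)
  then show ?case unfolding Suc.IH by (simp add: algebra_simps power_commutes)
qed simp

text \<open>The induced function \<open>F\<close> on the finite residue field inherits surjectivity
  and so is injective. Residues commute by Wedderburn, so the difference of its values at the two
  residues is the reduced quotient times their difference.\<close>

lemma not_zero_divisor_diff_quot_distinct:
  fixes f :: "'a::finite_local_ring poly"
  assumes f: "surj (right_subst f)" and ne: "abs_residue a \<noteq> abs_residue a'"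
  shows "\<not> zero_divisor (poly_diff_quot f a a')"
proof
  let ?c = "\<lambda>i. abs_residue (coeff f i)"
  define F where "F x = (\<Sum>i\<le>degree f. ?c i * x ^ i)" for x
  have "surj F"
    unfolding surj_def
  proof
    fix y
    obtain z :: 'a where "y = abs_residue z" by (metis surjD surj_abs_residue)
    moreover obtain x where "z = right_subst f x" using f by (metis surjD)
    ultimately have "y = F (abs_residue x)" by (simp add: F_def abs_residue_right_subst)
    then show "\<exists>x. y = F x" ..
  qed
  then have "inj F" by (rule finite_UNIV_surj_inj[OF finite])
  have "F (abs_residue a) - F (abs_residue a') =
      (\<Sum>i\<le>degree f. ?c i * (power_diff_quot (abs_residue a) (abs_residue a') i
        * (abs_residue a - abs_residue a')))"
    unfolding power_diff_quot_mult_diff[OF wedderburn_little] by (simp add: F_def right_diff_distrib sum_subtractf)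
  also have "\<dots> = abs_residue (poly_diff_quot f a a') * (abs_residue a - abs_residue a')"
    by (simp add: abs_residue_poly_diff_quot sum_distrib_right mult.assoc)
  finally have eq: "F (abs_residue a) - F (abs_residue a') =
    abs_residue (poly_diff_quot f a a') * (abs_residue a - abs_residue a')" .
  assume "zero_divisor (poly_diff_quot f a a')"
  then have "abs_residue (poly_diff_quot f a a') = 0" by (simp add: abs_residue_eq_0_iff)
  then have "F (abs_residue a) = F (abs_residue a')" using eq by simp
  then show False using \<open>inj F\<close> ne by (simp add: inj_eq)
qed

text \<open>On the square-zero ideal generated by \<open>q\<close> the polynomial function is affine, with linear part
  \<open>q * r \<mapsto> q * poly_deriv f a r\<close>.\<close>

lemma not_zero_divisor_diff_quot_equal:
  fixes f :: "'a::finite_local_ring poly"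
  assumes f: "inj (right_subst f)" and eq: "abs_residue a = abs_residue a'"
    and q: "\<And>x. q * x = x * q" "q * q = 0" "q \<noteq> (0 :: 'a)"
  shows "\<not> zero_divisor (poly_diff_quot f a a')"
proof
  assume zd: "zero_divisor (poly_diff_quot f a a')"
  let ?I = "range (\<lambda>r. q * r)"
  \<comment> \<open>Modulo the maximal ideal the derivative in direction \<open>r\<close> is the
    quotient times \<open>r\<close>, since the residues of \<open>a\<close> and \<open>a'\<close>
    agree and residues commute.\<close>
  have zd_deriv: "zero_divisor (poly_deriv f a r)" for r
  proof -
    have "abs_residue (poly_deriv f a r) =
        (\<Sum>i\<le>degree f. abs_residue (coeff f i) * power_deriv (abs_residue a) (abs_residue r) i)"
      by (simp add: abs_residue_hom poly_deriv_def abs_residue_sum abs_residue_power_deriv)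
    also have "\<dots> = abs_residue (poly_diff_quot f a a') * abs_residue r"
      using power_deriv_eq_diff_quot_mult[OF wedderburn_little, of "abs_residue a" "abs_residue r"]
      by (simp add: abs_residue_poly_diff_quot sum_distrib_right mult.assoc flip: eq)
    finally show ?thesis using zd by (simp flip: abs_residue_eq_0_iff)
  qed
  have aff: "right_subst f (a + q * r) = right_subst f a + q * poly_deriv f a r" for r
  proof -
    have "q * r * x * (q * r) = 0" for x
      by (metis mult.assoc mult_zero_left q(1,2))
    then show ?thesis
      using right_subst_add_square_zero[of "q * r" f a] poly_deriv_central_mult[OF q(1)] by simp
  qed
  have "inj_on (poly_deriv f a) ?I"
  proof (rule inj_onI)
    fix x y assume "x \<in> ?I" "y \<in> ?I" and deriv: "poly_deriv f a x = poly_deriv f a y"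
    then obtain r s where rs: "x = q * r" "y = q * s" by blast
    then have "right_subst f (a + x) = right_subst f (a + y)"
      using aff deriv poly_deriv_central_mult[OF q(1)] by metis
    then show "x = y" using f by (simp add: inj_eq)
  qed
  moreover have "poly_deriv f a ` ?I \<subseteq> ?I"
    using poly_deriv_central_mult[OF q(1)] by auto
  ultimately have "poly_deriv f a ` ?I = ?I" by (intro endo_inj_surj) auto
  moreover have "q \<in> ?I" by (rule image_eqI[of _ _ 1]) auto
  \<comment> \<open>Finiteness makes the linear part surjective on \<open>?I\<close>, so
    \<open>q\<close> is attained; then \<open>q\<close> is annihilated by
    \<open>1 - poly_deriv f a r\<close>, which is a unit.\<close>
  ultimately obtain r where "q = poly_deriv f a (q * r)" by auto
  then have "q * (1 - poly_deriv f a r) = 0"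
    using poly_deriv_central_mult[OF q(1)] by (simp add: algebra_simps)
  moreover have "\<not> zero_divisor (1 - poly_deriv f a r)"
    using zero_divisor_add[OF _ zd_deriv[of r], of "1 - poly_deriv f a r"] not_zero_divisor_1 by auto
  ultimately show False using q(3) by (auto simp: zero_divisor_def)
qed

lemma inj_poly_deriv:
  fixes f :: "'a::finite_chain_ring poly"
  assumes f: "permutation_poly f" and q: "\<And>x. q * x = x * q" "q * q = 0" "q \<noteq> (0 :: 'a)"
  shows "inj (poly_deriv f a)"
  unfolding inj_poly_deriv_iff
proof (intro allI impI)
  fix b assume b: "poly_deriv f a b = 0"
  obtain a' where a': "b * a = a' * b" by (rule principal_left_ideal_two_sided)
  have "\<not> zero_divisor (poly_diff_quot f a a')"
    using not_zero_divisor_diff_quot_distinct[of f a a']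
      not_zero_divisor_diff_quot_equal[of f a a', OF _ _ q] f
    by (auto simp: permutation_poly_def bij_def)
  moreover have "poly_diff_quot f a a' * b = 0"
    using b poly_deriv_eq_diff_quot_mult[OF a'] by simp
  ultimately show "b = 0" by (auto simp: zero_divisor_def)
qed

lemma ex_central_square_zero:
  assumes "prime p" and "c > 1" and "CHAR('a::ring_1) = p ^ c"
  shows "\<exists>q :: 'a. (\<forall>x. q * x = x * q) \<and> q * q = 0 \<and> q \<noteq> 0"
proof (intro exI conjI allI)
  let ?q = "of_nat (p ^ (c - 1)) :: 'a"
  show "?q * x = x * ?q" for x by (rule mult_of_nat_commute)
  \<comment> \<open>Uses \<open>c > 1\<close>: the exponent of \<open>?q * ?q\<close> reaches
    \<open>c\<close>.\<close>
  have "c \<le> (c - 1) + (c - 1)" using assms(2) by simp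
  then have "CHAR('a) dvd p ^ (c - 1) * p ^ (c - 1)"
    unfolding assms(3) power_add[symmetric] by (rule le_imp_power_dvd)
  then show "?q * ?q = 0" by (simp only: of_nat_mult[symmetric] of_nat_eq_0_iff_char_dvd)
  have "p ^ (c - 1) < p ^ c"
    using prime_gt_1_nat[OF assms(1)] assms(2) by (intro power_strict_increasing) auto
  moreover have "p ^ (c - 1) > 0" using prime_gt_0_nat[OF assms(1)] by simp
  ultimately show "?q \<noteq> 0"
    unfolding of_nat_eq_0_iff_char_dvd assms(3) by (auto dest: nat_dvd_not_less)
qed

theorem theorem5p18:
  fixes p c :: nat
    and f :: "('a::finite_chain_ring, 'k::finite) dual poly"
    and f0 :: "'a poly" and fs :: "'k \<Rightarrow> 'a poly"
  assumes "prime p" and "c > 1" and "CHAR('a) = p ^ c"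
    and "f = dual_poly f0 + (\<Sum>i\<in>UNIV. poly_mult_const (dual_poly (fs i)) (dual_var i))"
  shows "(permutation_poly f \<longleftrightarrow> permutation_poly (dual_poly f0 :: ('a, 'k) dual poly)) \<and>
         (permutation_poly (dual_poly f0 :: ('a, 'k) dual poly) \<longleftrightarrow> permutation_poly f0)"
proof -
  have "inj (poly_deriv f0 a)" if "permutation_poly f0" for a
    using ex_central_square_zero[OF assms(1-3)] inj_poly_deriv[OF that] by blast
  \<comment> \<open>Statement (2) is the instance of the criterion with all \<open>fs\<close>
    zero.\<close>
  moreover have "(dual_poly f0 :: ('a, 'k) dual poly) =
      dual_poly f0 + (\<Sum>i\<in>(UNIV :: 'k set). poly_mult_const (dual_poly 0) (dual_var i))"
    by (simp add: poly_mult_const_def dual_poly_def)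
  then have "permutation_poly (dual_poly f0 :: ('a, 'k) dual poly) \<longleftrightarrow>
      permutation_poly f0 \<and> (\<forall>a. inj (poly_deriv f0 a))"
    using permutation_poly_dual_iff[where fs = "\<lambda>_ :: 'k. 0" and ?f0.0 = f0] by simp
  ultimately show ?thesis
    using permutation_poly_dual_iff[of f0 fs] assms(4) by blast
qed

end
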